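(* Let $X\subset\mathbb{R}^n$ be a compact subset endowed with the induced topology. Let $S$ be the family of positive rational functions $f:=p(x)/q(x)$ on $X$ such that the coefficients of the polynomials $p$ and $q$ are non-negative. Then $\bar S=C^+(X,\mathbb{R})$.
   Context: $C^+(X,\mathbb{R})$ is the set of non-negative continuous functions $X\to\mathbb{R}$. $\bar S$ is the closure of $S$ in $C(X,\mathbb{R})$ with respect to the uniform (sup) norm on $X$. Polynomials are real polynomials in $n$ variables. A rational function $p/q$ on $X$ is understood to be defined at every point of $X$, with $q$ nowhere zero on $X$; "positive" means $f(x)>0$ for all $x\in X$. *)

theory Defs
  imports "HOL-Analysis.Analysis" "HOL-Library.Poly_Mapping"
begin

text \<open>
  A polynomial in the variables indexed by \<open>'n\<close> is a finitely supported map from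
  monomials \<open>'n \<Rightarrow>\<^sub>0 nat\<close> (exponent vectors) to their coefficients.
\<close>

type_synonym 'n real_mpoly = "('n \<Rightarrow>\<^sub>0 nat) \<Rightarrow>\<^sub>0 real"

definition mpoly_eval :: "'n::finite real_mpoly \<Rightarrow> real ^ 'n \<Rightarrow> real" where
  "mpoly_eval p x =
     (\<Sum>m\<in>Poly_Mapping.keys p. Poly_Mapping.lookup p m * (\<Prod>i\<in>UNIV. (x $ i) ^ Poly_Mapping.lookup m i))"

definition nonneg_coeffs :: "'n real_mpoly \<Rightarrow> bool" where
  "nonneg_coeffs p \<longleftrightarrow> (\<forall>m. Poly_Mapping.lookup p m \<ge> 0)"

text \<open>
  Functions on \<open>X\<close> are represented by total functions that are \<open>undefined\<close> outside \<open>X\<close>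
  (\<^const>\<open>extensional\<close>), as required by \<^const>\<open>cfunspace\<close>. The latter consists of the bounded
  continuous functions with the supremum metric; for compact \<open>X\<close> boundedness is automatic.
\<close>

definition cont_space :: "(real ^ 'n::finite) set \<Rightarrow> (real ^ 'n \<Rightarrow> real) metric" where
  "cont_space X = cfunspace (top_of_set X) euclidean_metric"

definition cont_nonneg :: "(real ^ 'n::finite) set \<Rightarrow> (real ^ 'n \<Rightarrow> real) set" where
  "cont_nonneg X = {f \<in> mspace (cont_space X). \<forall>x\<in>X. f x \<ge> 0}"

definition pos_rational_nonneg_coeffs :: "(real ^ 'n::finite) set \<Rightarrow> (real ^ 'n \<Rightarrow> real) set" where
  "pos_rational_nonneg_coeffs X =
     {f. \<exists>p q. nonneg_coeffs p \<and> nonneg_coeffs q \<and>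
           (\<forall>x\<in>X. mpoly_eval q x \<noteq> 0) \<and>
           f = restrict (\<lambda>x. mpoly_eval p x / mpoly_eval q x) X \<and>
           (\<forall>x\<in>X. f x > 0)}"

text \<open>
  Since \<open>closure_of\<close> discards points outside the topological space, we record that nothing is
  discarded here.
\<close>

lemma pos_rational_nonneg_coeffs_subset:
  assumes "compact X"
  shows "pos_rational_nonneg_coeffs X \<subseteq> mspace (cont_space X)"
proof
  fix f assume "f \<in> pos_rational_nonneg_coeffs X"
  then obtain p q where q: "\<forall>x\<in>X. mpoly_eval q x \<noteq> 0"
    and f: "f = restrict (\<lambda>x. mpoly_eval p x / mpoly_eval q x) X"
    unfolding pos_rational_nonneg_coeffs_def by blast
  have "continuous_on X (\<lambda>x. mpoly_eval p x / mpoly_eval q x)"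
    using q unfolding mpoly_eval_def by (intro continuous_intros) auto
  then have c: "continuous_on X f"
    unfolding f by (simp cong: continuous_on_cong)
  then have "compact (f ` X)"
    using assms compact_continuous_image by blast
  then have "compactin (mtopology_of euclidean_metric) (f ` X)"
    by simp
  then have "Metric_space.mbounded (mspace euclidean_metric) (mdist euclidean_metric) (f ` X)"
    unfolding mtopology_of_def
    by (rule Metric_space.compactin_imp_mbounded[OF Metric_space_mspace_mdist])
  then show "f \<in> mspace (cont_space X)"
    using c f by (auto simp: cont_space_def)
qed

end

theory Submission
  imports Defs
begin

text \<open>
  The set \<open>S\<close> of positive rational functions with non-negative coefficients contains the positive
  constants and is closed under sums, products and quotients. As \<open>X\<close> is bounded, \<open>S\<close> contains
  \<open>x\<^sub>i + R\<close> for large \<open>R\<close>, so \<open>S - S\<close> is a point-separating algebra, which is dense in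
  \<open>C(X,\<real>)\<close> by Stone--Weierstrass. It remains to approximate a positive difference \<open>f\<^sub>1 - f\<^sub>2\<close> of
  elements of \<open>S\<close>: the quotient \<open>u = f\<^sub>2 / f\<^sub>1\<close> is bounded by some \<open>\<theta> < 1\<close>, so the elements
  \<open>f\<^sub>1 / (1 + u + \<dots> + u\<^sup>n)\<close> of \<open>S\<close> converge uniformly to \<open>f\<^sub>1 (1 - u) = f\<^sub>1 - f\<^sub>2\<close>.
\<close>

section \<open>Evaluation of polynomials\<close>

text \<open>Monomials outside the support contribute zero, so different polynomials can be evaluated
  over one common finite index set.\<close>

lemma mpoly_eval_superset:
  assumes "finite A" "Poly_Mapping.keys p \<subseteq> A"
  shows "mpoly_eval p x =
    (\<Sum>m\<in>A. Poly_Mapping.lookup p m * (\<Prod>i\<in>UNIV. (x $ i) ^ Poly_Mapping.lookup m i))"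
  unfolding mpoly_eval_def
  by (rule sum.mono_neutral_left) (use assms in \<open>auto simp: in_keys_iff\<close>)

lemma mpoly_eval_add: "mpoly_eval (p + q) x = mpoly_eval p x + mpoly_eval q x"
proof -
  let ?A = "Poly_Mapping.keys p \<union> Poly_Mapping.keys q"
  have A: "finite ?A" by simp
  show ?thesis
    using keys_add[of p q]
    by (simp add: mpoly_eval_superset[OF A] lookup_add distrib_right sum.distrib)
qed

lemma mpoly_eval_single:
  "mpoly_eval (Poly_Mapping.single m c) x = c * (\<Prod>i\<in>UNIV. (x $ i) ^ Poly_Mapping.lookup m i)"
  \<comment> \<open>The superset \<open>{m}\<close> also covers \<open>c = 0\<close>, where the
    support is empty.\<close>
  by (subst mpoly_eval_superset[of "{m}"]) auto

lemma mpoly_eval_zero: "mpoly_eval 0 x = 0"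
  by (simp add: mpoly_eval_def)

lemma mpoly_eval_one: "mpoly_eval 1 x = 1"
  using mpoly_eval_single[of 0 1 x] by simp

lemma mpoly_eval_sum: "mpoly_eval (\<Sum>i\<in>I. p i) x = (\<Sum>i\<in>I. mpoly_eval (p i) x)"
  by (induction I rule: infinite_finite_induct) (auto simp: mpoly_eval_zero mpoly_eval_add)

lemma poly_mapping_eq_sum_single:
  fixes p :: "'a \<Rightarrow>\<^sub>0 'b::comm_monoid_add"
  shows "p = (\<Sum>m\<in>Poly_Mapping.keys p. Poly_Mapping.single m (Poly_Mapping.lookup p m))"
  by (rule poly_mapping_eqI)
    (simp add: lookup_sum lookup_single when_def in_keys_iff)

text \<open>Expanding both factors into monomials reduces a product to single terms. This yields
  both multiplicativity of evaluation and non-negativity of the coefficients of a product.\<close>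

lemma poly_mapping_times_eq_sum_single:
  fixes p q :: "'n real_mpoly"
  shows "p * q = (\<Sum>m\<in>Poly_Mapping.keys p. \<Sum>k\<in>Poly_Mapping.keys q.
    Poly_Mapping.single (m + k) (Poly_Mapping.lookup p m * Poly_Mapping.lookup q k))"
proof -
  have "p * q = (\<Sum>m\<in>Poly_Mapping.keys p. Poly_Mapping.single m (Poly_Mapping.lookup p m)) *
      (\<Sum>k\<in>Poly_Mapping.keys q. Poly_Mapping.single k (Poly_Mapping.lookup q k))"
    by (rule arg_cong2[OF poly_mapping_eq_sum_single poly_mapping_eq_sum_single])
  then show ?thesis
    by (simp only: sum_product mult_single)
qed

lemma mpoly_eval_mult: "mpoly_eval (p * q) x = mpoly_eval p x * mpoly_eval q x"
proof -
  have "mpoly_eval (p * q) x = (\<Sum>m\<in>Poly_Mapping.keys p. \<Sum>k\<in>Poly_Mapping.keys q.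
    (Poly_Mapping.lookup p m * (\<Prod>i\<in>UNIV. (x $ i) ^ Poly_Mapping.lookup m i)) *
    (Poly_Mapping.lookup q k * (\<Prod>i\<in>UNIV. (x $ i) ^ Poly_Mapping.lookup k i)))"
    unfolding poly_mapping_times_eq_sum_single[of p q]
    by (simp add: mpoly_eval_sum mpoly_eval_single lookup_add power_add prod.distrib ac_simps)
  then show ?thesis
    by (simp add: mpoly_eval_def sum_product)
qed

lemma nonneg_coeffs_add: "nonneg_coeffs p \<Longrightarrow> nonneg_coeffs q \<Longrightarrow> nonneg_coeffs (p + q)"
  by (simp add: nonneg_coeffs_def lookup_add)

lemma nonneg_coeffs_single: "c \<ge> 0 \<Longrightarrow> nonneg_coeffs (Poly_Mapping.single m c)"
  by (simp add: nonneg_coeffs_def lookup_single when_def)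

lemma nonneg_coeffs_one: "nonneg_coeffs 1"
  using nonneg_coeffs_single[of 1 0] by simp

lemma nonneg_coeffs_mult: "nonneg_coeffs p \<Longrightarrow> nonneg_coeffs q \<Longrightarrow> nonneg_coeffs (p * q)"
  unfolding nonneg_coeffs_def poly_mapping_times_eq_sum_single[of p q]
  by (auto simp: lookup_sum lookup_single when_def intro!: sum_nonneg)

section \<open>Positive rational functions with non-negative coefficients\<close>

text \<open>Only the values on \<open>X\<close> matter in this form, so the closure properties below
  can be stated for arbitrary total functions without handling \<open>undefined\<close>.\<close>

lemma restrict_pos_rational_iff:
  "restrict f X \<in> pos_rational_nonneg_coeffs X \<longleftrightarrow>
    (\<exists>p q. nonneg_coeffs p \<and> nonneg_coeffs q \<and>
      (\<forall>x\<in>X. mpoly_eval q x \<noteq> 0 \<and> f x = mpoly_eval p x / mpoly_eval q x \<and> f x > 0))"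
  (is "?L \<longleftrightarrow> ?R")
proof
  assume ?L
  then obtain p q where *: "nonneg_coeffs p" "nonneg_coeffs q"
    "\<forall>x\<in>X. mpoly_eval q x \<noteq> 0"
    "restrict f X = restrict (\<lambda>x. mpoly_eval p x / mpoly_eval q x) X" "\<forall>x\<in>X. restrict f X x > 0"
    unfolding pos_rational_nonneg_coeffs_def by blast
  have "f x = mpoly_eval p x / mpoly_eval q x" if "x \<in> X" for x
    using fun_cong[OF *(4), of x] that by simp
  then have "\<forall>x\<in>X. mpoly_eval q x \<noteq> 0 \<and> f x = mpoly_eval p x / mpoly_eval q x \<and> f x > 0"
    using *(3,5) by fastforce
  with *(1,2) show ?R by blast
next
  assume ?R
  then obtain p q where *: "nonneg_coeffs p" "nonneg_coeffs q"
    "\<forall>x\<in>X. mpoly_eval q x \<noteq> 0 \<and> f x = mpoly_eval p x / mpoly_eval q x \<and> f x > 0"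
    by blast
  then have "restrict f X = restrict (\<lambda>x. mpoly_eval p x / mpoly_eval q x) X"
    by (intro restrict_ext) blast
  moreover have "restrict f X x > 0" if "x \<in> X" for x
    using *(3) that by (metis restrict_apply')
  ultimately show ?L
    unfolding pos_rational_nonneg_coeffs_def using * by blast
qed

lemma pos_rationalI:
  assumes "nonneg_coeffs p" "nonneg_coeffs q"
    and "\<And>x. x \<in> X \<Longrightarrow> mpoly_eval q x \<noteq> 0"
    and "\<And>x. x \<in> X \<Longrightarrow> f x = mpoly_eval p x / mpoly_eval q x"
    and "\<And>x. x \<in> X \<Longrightarrow> f x > 0"
  shows "restrict f X \<in> pos_rational_nonneg_coeffs X"
  unfolding restrict_pos_rational_iff using assms by blast

lemma pos_rational_pos:
  "restrict f X \<in> pos_rational_nonneg_coeffs X \<Longrightarrow> x \<in> X \<Longrightarrow> f x > 0"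
  by (auto simp: restrict_pos_rational_iff)

lemma pos_rational_continuous_on:
  assumes "restrict f X \<in> pos_rational_nonneg_coeffs X"
  shows "continuous_on X f"
proof -
  obtain p q where q: "\<forall>x\<in>X. mpoly_eval q x \<noteq> 0"
    and f: "\<forall>x\<in>X. f x = mpoly_eval p x / mpoly_eval q x"
    using assms unfolding restrict_pos_rational_iff by blast
  have "continuous_on X (\<lambda>x. mpoly_eval p x / mpoly_eval q x)"
    using q unfolding mpoly_eval_def by (intro continuous_intros) auto
  then show ?thesis
    using f by (simp cong: continuous_on_cong)
qed

lemma pos_rational_const:
  assumes "c > 0"
  shows "restrict (\<lambda>_. c) X \<in> pos_rational_nonneg_coeffs X"
  by (rule pos_rationalI[of "Poly_Mapping.single 0 c" 1])
    (use assms in \<open>auto simp: mpoly_eval_single mpoly_eval_one nonneg_coeffs_single nonneg_coeffs_one\<close>)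

text \<open>A coordinate may be negative on \<open>X\<close>; a shift by \<open>R\<close> makes it
  positive, and \<open>R \<ge> 0\<close> keeps the coefficients non-negative.\<close>

lemma pos_rational_coordinate:
  assumes "R \<ge> 0" "\<And>x. x \<in> X \<Longrightarrow> x $ i + R > 0"
  shows "restrict (\<lambda>x. x $ i + R) X \<in> pos_rational_nonneg_coeffs X"
proof -
  let ?p = "Poly_Mapping.single (Poly_Mapping.single i 1) 1 + Poly_Mapping.single 0 R"
  \<comment> \<open>All factors with \<open>j\<close> different from \<open>i\<close> have exponent
    0.\<close>
  have "(\<Prod>j\<in>UNIV. (x $ j) ^ Poly_Mapping.lookup (Poly_Mapping.single i 1) j) = x $ i"
    for x :: "real ^ 'a"
    by (simp add: lookup_single when_def if_distrib[of "power _"] cong: if_cong)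
  then have "mpoly_eval ?p x = x $ i + R" for x
    by (simp add: mpoly_eval_add mpoly_eval_single)
  moreover have "nonneg_coeffs ?p"
    using assms by (intro nonneg_coeffs_add nonneg_coeffs_single) auto
  ultimately show ?thesis
    by (intro pos_rationalI[of ?p 1])
      (use assms in \<open>auto simp: mpoly_eval_single mpoly_eval_one nonneg_coeffs_single nonneg_coeffs_one\<close>)
qed

lemma pos_rational_add:
  assumes "restrict f X \<in> pos_rational_nonneg_coeffs X" "restrict g X \<in> pos_rational_nonneg_coeffs X"
  shows "restrict (\<lambda>x. f x + g x) X \<in> pos_rational_nonneg_coeffs X"
proof -
  obtain p q where f: "nonneg_coeffs p" "nonneg_coeffs q"
    "\<forall>x\<in>X. mpoly_eval q x \<noteq> 0 \<and> f x = mpoly_eval p x / mpoly_eval q x \<and> f x > 0"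
    using assms(1) unfolding restrict_pos_rational_iff by blast
  obtain r s where g: "nonneg_coeffs r" "nonneg_coeffs s"
    "\<forall>x\<in>X. mpoly_eval s x \<noteq> 0 \<and> g x = mpoly_eval r x / mpoly_eval s x \<and> g x > 0"
    using assms(2) unfolding restrict_pos_rational_iff by blast
  show ?thesis
  proof (rule pos_rationalI)
    show "nonneg_coeffs (p * s + r * q)" "nonneg_coeffs (q * s)"
      using f g by (simp_all add: nonneg_coeffs_add nonneg_coeffs_mult)
    fix x assume "x \<in> X"
    with f(3) g(3) have "mpoly_eval q x \<noteq> 0" "f x = mpoly_eval p x / mpoly_eval q x"
      "mpoly_eval s x \<noteq> 0" "g x = mpoly_eval r x / mpoly_eval s x"
      and pos: "f x > 0" "g x > 0"
      by blast+
    then show "mpoly_eval (q * s) x \<noteq> 0"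
      "f x + g x = mpoly_eval (p * s + r * q) x / mpoly_eval (q * s) x"
      by (simp_all add: mpoly_eval_add mpoly_eval_mult add_frac_eq)
    show "f x + g x > 0"
      using pos by (rule add_pos_pos)
  qed
qed

lemma pos_rational_mult:
  assumes "restrict f X \<in> pos_rational_nonneg_coeffs X" "restrict g X \<in> pos_rational_nonneg_coeffs X"
  shows "restrict (\<lambda>x. f x * g x) X \<in> pos_rational_nonneg_coeffs X"
proof -
  obtain p q where f: "nonneg_coeffs p" "nonneg_coeffs q"
    "\<forall>x\<in>X. mpoly_eval q x \<noteq> 0 \<and> f x = mpoly_eval p x / mpoly_eval q x \<and> f x > 0"
    using assms(1) unfolding restrict_pos_rational_iff by blast
  obtain r s where g: "nonneg_coeffs r" "nonneg_coeffs s"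
    "\<forall>x\<in>X. mpoly_eval s x \<noteq> 0 \<and> g x = mpoly_eval r x / mpoly_eval s x \<and> g x > 0"
    using assms(2) unfolding restrict_pos_rational_iff by blast
  show ?thesis
  proof (rule pos_rationalI)
    show "nonneg_coeffs (p * r)" "nonneg_coeffs (q * s)"
      using f g by (simp_all add: nonneg_coeffs_mult)
    fix x assume "x \<in> X"
    with f(3) g(3) have "mpoly_eval q x \<noteq> 0" "f x = mpoly_eval p x / mpoly_eval q x"
      "mpoly_eval s x \<noteq> 0" "g x = mpoly_eval r x / mpoly_eval s x"
      and pos: "f x > 0" "g x > 0"
      by blast+
    then show "mpoly_eval (q * s) x \<noteq> 0"
      "f x * g x = mpoly_eval (p * r) x / mpoly_eval (q * s) x"
      by (simp_all add: mpoly_eval_mult)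
    show "f x * g x > 0"
      using pos by (rule mult_pos_pos)
  qed
qed

text \<open>Positivity of \<open>f\<close> keeps the numerator from vanishing on \<open>X\<close>,
  so numerator and denominator can be swapped.\<close>

lemma pos_rational_inverse:
  assumes "restrict f X \<in> pos_rational_nonneg_coeffs X"
  shows "restrict (\<lambda>x. inverse (f x)) X \<in> pos_rational_nonneg_coeffs X"
proof -
  obtain p q where f: "nonneg_coeffs p" "nonneg_coeffs q"
    "\<forall>x\<in>X. mpoly_eval q x \<noteq> 0 \<and> f x = mpoly_eval p x / mpoly_eval q x \<and> f x > 0"
    using assms unfolding restrict_pos_rational_iff by blast
  show ?thesis
  proof (rule pos_rationalI[OF f(2,1)])
    fix x assume "x \<in> X"
    with f(3) have f_eq: "f x = mpoly_eval p x / mpoly_eval q x" and pos: "f x > 0"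
      by blast+
    then show "mpoly_eval p x \<noteq> 0" "inverse (f x) = mpoly_eval q x / mpoly_eval p x"
      by auto
    show "inverse (f x) > 0"
      using pos by simp
  qed
qed

lemma pos_rational_divide:
  assumes "restrict f X \<in> pos_rational_nonneg_coeffs X" "restrict g X \<in> pos_rational_nonneg_coeffs X"
  shows "restrict (\<lambda>x. f x / g x) X \<in> pos_rational_nonneg_coeffs X"
  using pos_rational_mult[OF assms(1) pos_rational_inverse[OF assms(2)]]
  by (simp add: divide_inverse)

lemma pos_rational_power:
  assumes "restrict f X \<in> pos_rational_nonneg_coeffs X"
  shows "restrict (\<lambda>x. f x ^ n) X \<in> pos_rational_nonneg_coeffs X"
proof (induction n)
  case 0
  show ?case using pos_rational_const[of 1 X] by (simp add: restrict_def)
next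
  case (Suc n)
  from pos_rational_mult[OF assms this] show ?case by (simp add: restrict_def)
qed

lemma pos_rational_geometric_sum:
  assumes "restrict f X \<in> pos_rational_nonneg_coeffs X"
  shows "restrict (\<lambda>x. \<Sum>k\<le>n. f x ^ k) X \<in> pos_rational_nonneg_coeffs X"
proof (induction n)
  case 0
  show ?case using pos_rational_const[of 1 X] by (simp add: restrict_def)
next
  case (Suc n)
  from pos_rational_add[OF this pos_rational_power[OF assms, of "Suc n"]]
  show ?case by (simp add: restrict_def)
qed

section \<open>Density\<close>

text \<open>For the geometric sum \<open>s\<close>, the identity
  \<open>(1 - u) * s = 1 - u ^ Suc n\<close> makes the error exactly \<open>u ^ Suc n / s\<close>,
  and \<open>s \<ge> 1\<close> because its term of index 0 is 1.\<close>

lemma one_minus_geometric_approx: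
  fixes u :: real
  assumes "0 \<le> u"
  shows "\<bar>(1 - u) - 1 / (\<Sum>k\<le>n. u ^ k)\<bar> \<le> u ^ Suc n"
proof -
  define s where "s = (\<Sum>k\<le>n. u ^ k)"
  have "s = 1 + (\<Sum>k\<in>{..n} - {0}. u ^ k)"
    unfolding s_def by (subst sum.remove[of _ 0]) auto
  moreover have "0 \<le> (\<Sum>k\<in>{..n} - {0}. u ^ k)"
    using assms by (intro sum_nonneg) auto
  ultimately have s: "s \<ge> 1" by linarith
  have "(1 - u) * s = 1 - u ^ Suc n"
    unfolding s_def by (rule sum_gp_basic)
  then have "(1 - u) - 1 / s = - (u ^ Suc n / s)"
    using s by (simp add: eq_divide_eq diff_divide_distrib divide_simps)
  moreover have "u ^ Suc n / s \<le> u ^ Suc n / 1"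
    using s assms by (intro divide_left_mono) auto
  moreover have "0 \<le> u ^ Suc n / s"
    using s assms by (intro divide_nonneg_nonneg) auto
  ultimately show ?thesis
    unfolding s_def[symmetric] by linarith
qed

lemma pos_rational_approx_diff:
  assumes X: "compact X"
    and f: "restrict f X \<in> pos_rational_nonneg_coeffs X"
    and g: "restrict g X \<in> pos_rational_nonneg_coeffs X"
    and less: "\<And>x. x \<in> X \<Longrightarrow> g x < f x" and e: "e > 0"
  obtains h where "restrict h X \<in> pos_rational_nonneg_coeffs X"
    "\<And>x. x \<in> X \<Longrightarrow> \<bar>(f x - g x) - h x\<bar> < e"
\<comment> \<open>The maxima used below exist only on a nonempty set; on the empty set any member of
  the family serves.\<close>
proof (cases "X = {}")
  case True
  then show ?thesis using that[OF f] by simp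
next
  case False
  define u where "u = (\<lambda>x. g x / f x)"
  have u: "restrict u X \<in> pos_rational_nonneg_coeffs X"
    unfolding u_def by (rule pos_rational_divide[OF g f])
  note cont = pos_rational_continuous_on and pos = pos_rational_pos
  obtain a where a: "a \<in> X" "\<And>x. x \<in> X \<Longrightarrow> u x \<le> u a"
    using continuous_attains_sup[OF X False cont[OF u]] by blast
  obtain b where b: "b \<in> X" "\<And>x. x \<in> X \<Longrightarrow> f x \<le> f b"
    using continuous_attains_sup[OF X False cont[OF f]] by blast
  \<comment> \<open>Since \<open>u\<close> attains its maximum at \<open>a\<close>, the pointwise
    inequality \<open>g x < f x\<close> becomes a uniform bound on \<open>u\<close> below 1.\<close>
  have "u a < 1"
    unfolding u_def using less[OF a(1)] pos[OF f a(1)] by simp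
  moreover have "0 < e / f b"
    using e pos[OF f b(1)] by simp
  ultimately obtain n where n: "u a ^ n < e / f b"
    using real_arch_pow_inv by blast
  define h where "h = (\<lambda>x. f x / (\<Sum>k\<le>n. u x ^ k))"
  show ?thesis
  proof (rule that)
    show "restrict h X \<in> pos_rational_nonneg_coeffs X"
      unfolding h_def by (intro pos_rational_divide f pos_rational_geometric_sum u)
    fix x assume x: "x \<in> X"
    note fx = pos[OF f x] and ux = pos[OF u x] and ua = pos[OF u a(1)]
    \<comment> \<open>Factoring out \<open>f x\<close> leaves the error of the geometric
      approximation, while \<open>f x\<close> itself is bounded by \<open>f b\<close>.\<close>
    have "(f x - g x) - h x = f x * ((1 - u x) - 1 / (\<Sum>k\<le>n. u x ^ k))"
      using fx by (simp add: h_def u_def right_diff_distrib)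
    then have "\<bar>(f x - g x) - h x\<bar> = f x * \<bar>(1 - u x) - 1 / (\<Sum>k\<le>n. u x ^ k)\<bar>"
      using fx by (simp add: abs_mult)
    also have "\<dots> \<le> f x * u x ^ Suc n"
      using one_minus_geometric_approx[of "u x" n] fx ux by (intro mult_left_mono) auto
    also have "\<dots> \<le> f b * u a ^ Suc n"
      using a(2)[OF x] b(2)[OF x] fx ux by (intro mult_mono power_mono) auto
    \<comment> \<open>The exponent drops by one because \<open>n\<close> was chosen with
      \<open>u a ^ n < e / f b\<close>.\<close>
    also have "\<dots> \<le> f b * u a ^ n"
      using \<open>u a < 1\<close> ua pos[OF f b(1)] by (intro mult_left_mono power_decreasing) auto
    also have "\<dots> < e"
      using n pos[OF f b(1)] by (simp add: field_simps)
    finally show "\<bar>(f x - g x) - h x\<bar> < e" .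
  qed
qed

lemma pos_rational_diff_dense:
  fixes X :: "(real ^ 'n::finite) set"
  assumes X: "compact X" and F: "continuous_on X F" and e: "e > 0"
  obtains f g where "restrict f X \<in> pos_rational_nonneg_coeffs X"
    "restrict g X \<in> pos_rational_nonneg_coeffs X"
    "\<And>x. x \<in> X \<Longrightarrow> \<bar>F x - (f x - g x)\<bar> < e"
proof -
  \<comment> \<open>\<open>P\<close> describes the algebra of differences of members of the family,
    up to values outside \<open>X\<close>.\<close>
  define P where "P = (\<lambda>h. \<exists>f g. restrict f X \<in> pos_rational_nonneg_coeffs X \<and>
    restrict g X \<in> pos_rational_nonneg_coeffs X \<and> (\<forall>x\<in>X. h x = f x - g x))"
  have PI: "P h" if "restrict f X \<in> pos_rational_nonneg_coeffs X"
    "restrict g X \<in> pos_rational_nonneg_coeffs X" "\<And>x. x \<in> X \<Longrightarrow> h x = f x - g x" for f g h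
    using that unfolding P_def by blast
  have "\<exists>h. P h \<and> (\<forall>x\<in>X. \<bar>F x - h x\<bar> < e)"
  proof (rule Stone_Weierstrass_HOL[OF X _ _ _ _ _ F e])
    show "P (\<lambda>_. c)" for c
      \<comment> \<open>Both constants are positive whatever the sign of \<open>c\<close>, and they
        differ by \<open>c\<close>.\<close>
      by (rule PI[OF pos_rational_const[of "\<bar>c\<bar> + c + 1"] pos_rational_const[of "\<bar>c\<bar> + 1"]]) auto
    show "continuous_on X h" if "P h" for h
    proof -
      obtain f g where *: "restrict f X \<in> pos_rational_nonneg_coeffs X"
        "restrict g X \<in> pos_rational_nonneg_coeffs X" "\<forall>x\<in>X. h x = f x - g x"
        using \<open>P h\<close> unfolding P_def by blast
      have "continuous_on X (\<lambda>x. f x - g x)"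
        by (intro continuous_intros pos_rational_continuous_on *)
      then show ?thesis
        using *(3) by (simp cong: continuous_on_cong)
    qed
    fix h k assume hk: "P h \<and> P k"
    obtain f g where fg: "restrict f X \<in> pos_rational_nonneg_coeffs X"
      "restrict g X \<in> pos_rational_nonneg_coeffs X" "\<forall>x\<in>X. h x = f x - g x"
      using hk unfolding P_def by blast
    obtain f' g' where fg': "restrict f' X \<in> pos_rational_nonneg_coeffs X"
      "restrict g' X \<in> pos_rational_nonneg_coeffs X" "\<forall>x\<in>X. k x = f' x - g' x"
      using hk unfolding P_def by blast
    show "P (\<lambda>x. h x + k x)"
      by (rule PI[OF pos_rational_add[OF fg(1) fg'(1)] pos_rational_add[OF fg(2) fg'(2)]])
        (simp add: fg(3) fg'(3))
    \<comment> \<open>The product \<open>(f - g) * (f' - g')\<close> splits as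
      \<open>(f * f' + g * g') - (f * g' + g * f')\<close>.\<close>
    show "P (\<lambda>x. h x * k x)"
      by (rule PI[OF pos_rational_add[OF pos_rational_mult[OF fg(1) fg'(1)]
              pos_rational_mult[OF fg(2) fg'(2)]]
            pos_rational_add[OF pos_rational_mult[OF fg(1) fg'(2)]
              pos_rational_mult[OF fg(2) fg'(1)]]])
        (simp add: fg(3) fg'(3) algebra_simps)
  next
    fix x y :: "real ^ 'n" assume "x \<in> X \<and> y \<in> X \<and> x \<noteq> y"
    then obtain i where i: "x $ i \<noteq> y $ i"
      by (auto simp: vec_eq_iff)
    obtain R where R: "R > 0" "\<And>z. z \<in> X \<Longrightarrow> norm z < R"
      using compact_imp_bounded[OF X] by (auto simp: bounded_pos_less)
    have pos: "z $ i + R > 0" if "z \<in> X" for z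
      using component_le_norm_cart[of z i] R(2)[OF that] by linarith
    \<comment> \<open>Subtracting the positive constant 1 exhibits a difference of two members; it
      still separates \<open>x\<close> from \<open>y\<close>.\<close>
    have "P (\<lambda>z. (z $ i + R) - 1)"
      by (rule PI[OF pos_rational_coordinate pos_rational_const[of 1]]) (use R pos in auto)
    with i show "\<exists>f. P f \<and> f x \<noteq> f y"
      by (intro exI[of _ "\<lambda>z. (z $ i + R) - 1"]) auto
  qed
  then show thesis
    using that unfolding P_def by metis
qed

text \<open>\<open>F\<close> may have zeros, so \<open>F + e / 4\<close> is approximated instead,
  which leaves room for the approximating difference to be positive.\<close>

lemma pos_rational_dense:
  assumes X: "compact X" and F: "continuous_on X F" "\<And>x. x \<in> X \<Longrightarrow> F x \<ge> 0" and e: "e > 0"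
  obtains h where "restrict h X \<in> pos_rational_nonneg_coeffs X"
    "\<And>x. x \<in> X \<Longrightarrow> \<bar>F x - h x\<bar> < e"
proof -
  have e4: "e / 4 > 0" using e by simp
  have "continuous_on X (\<lambda>x. F x + e / 4)"
    by (intro continuous_intros F)
  from pos_rational_diff_dense[OF X this e4] obtain f g
    where f: "restrict f X \<in> pos_rational_nonneg_coeffs X"
      and g: "restrict g X \<in> pos_rational_nonneg_coeffs X"
      and fg: "\<And>x. x \<in> X \<Longrightarrow> \<bar>F x + e / 4 - (f x - g x)\<bar> < e / 4"
    by blast
  \<comment> \<open>An error below \<open>e / 4\<close> gives \<open>f x - g x > F x\<close>, and
    \<open>F x \<ge> 0\<close>.\<close>
  have "g x < f x" if "x \<in> X" for x
    using fg[OF that] F(2)[OF that] by linarith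
  from pos_rational_approx_diff[OF X f g this e4] obtain h
    where h: "restrict h X \<in> pos_rational_nonneg_coeffs X"
      and fgh: "\<And>x. x \<in> X \<Longrightarrow> \<bar>f x - g x - h x\<bar> < e / 4"
    by blast
  show thesis
  proof (rule that[OF h])
    fix x assume x: "x \<in> X"
    \<comment> \<open>The shift and the two approximations cost at most \<open>e / 4\<close>
      each.\<close>
    show "\<bar>F x - h x\<bar> < e"
      using fg[OF x] fgh[OF x] e by linarith
  qed
qed

theorem theorem1p14:
  fixes X :: "(real ^ 'n::finite) set"
  assumes "compact X"
  shows "mtopology_of (cont_space X) closure_of (pos_rational_nonneg_coeffs X) = cont_nonneg X"
proof -
  let ?S = "pos_rational_nonneg_coeffs X" and ?d = "mdist (cont_space X)"
  have sub: "?S \<subseteq> mspace (cont_space X)"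
    using assms by (rule pos_rational_nonneg_coeffs_subset)
  \<comment> \<open>Closed balls match the non-strict pointwise estimates that characterise the
    supremum distance.\<close>
  have closure: "mtopology_of (cont_space X) closure_of ?S =
      {f \<in> mspace (cont_space X). \<forall>r>0. \<exists>g\<in>?S. ?d f g \<le> r}"
    unfolding mtopology_of_def Metric_space.metric_closure_of_alt[OF Metric_space_mspace_mdist]
    using sub by (auto simp: Metric_space.in_mcball[OF Metric_space_mspace_mdist]) blast
  have "f x \<ge> 0"
    if f: "f \<in> mspace (cont_space X)" "\<forall>r>0. \<exists>g\<in>?S. ?d f g \<le> r" and x: "x \<in> X" for f x
  proof (rule ccontr)
    assume neg: "\<not> f x \<ge> 0"
    \<comment> \<open>The radius \<open>- f x\<close> is the distance from \<open>f x\<close> to 0: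
      being that close forces \<open>g x \<le> 0\<close>, against positivity of
      \<open>g\<close>.\<close>
    then obtain g where g: "g \<in> ?S" "?d f g \<le> - f x"
      using f(2) by (metis neg_0_less_iff_less not_le)
    have "mdist euclidean_metric (f x) (g x) \<le> - f x"
      using mdist_cfunspace_imp_mdist_le[of f "top_of_set X" euclidean_metric g "- f x" x] f(1) g sub x
      unfolding cont_space_def by auto
    moreover have "g x > 0"
      using g(1) x by (auto simp: pos_rational_nonneg_coeffs_def)
    ultimately show False
      using neg by (simp add: dist_real_def)
  qed
  \<comment> \<open>For the converse inclusion, uniform approximation on \<open>X\<close> bounds the
    supremum distance by \<open>r\<close>.\<close>
  moreover have "\<exists>g\<in>?S. ?d f g \<le> r"
    if f: "f \<in> mspace (cont_space X)" "\<forall>x\<in>X. f x \<ge> 0" and r: "r > 0" for f r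
  proof -
    have "continuous_on X f"
      using f(1) by (simp add: cont_space_def)
    then obtain h where h: "restrict h X \<in> ?S" "\<And>x. x \<in> X \<Longrightarrow> \<bar>f x - h x\<bar> < r"
      using pos_rational_dense[OF assms, of f r] f(2) r by blast
    have "?d f (restrict h X) \<le> r"
      unfolding cont_space_def
      by (rule mdist_cfunspace_le) (use r h(2) in \<open>auto simp: dist_real_def less_imp_le\<close>)
    with h(1) show ?thesis by blast
  qed
  ultimately show ?thesis
    unfolding closure cont_nonneg_def by blast
qed

end
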